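(* Let $P\in\mathbb{Z}[x]$ be a monic polynomial and let $f_P(z)=\sum_{n=1}^\infty\Delta(P_n)z^n$. Then there exist polynomials $u_1,\dots,u_r\in\mathbb{Z}[z]$ and rational numbers $c_1,\dots,c_r$ such that $$f_P(z)=\sum_{j=1}^r c_j\,\frac{z\,u_j'(z)}{u_j(z)}.$$
   Context: If $P$ has degree $d$ and roots $\alpha_1,\dots,\alpha_d$ (with multiplicity), then $P_n(x):=\prod_{j=1}^d(x-\alpha_j^n)\in\mathbb{Z}[x]$ for $n\ge1$ and $\Delta(P_n)=\prod_{1\le j<k\le d}(\alpha_j^n-\alpha_k^n)^2$ is its discriminant. *)

theory Defs
  imports
    "HOL-Computational_Algebra.Computational_Algebra"
    "HOL-Combinatorics.Permutations"
begin

abbreviation complex_poly :: "int poly \<Rightarrow> complex poly" where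
  "complex_poly p \<equiv> map_poly of_int p"

definition root_power_poly :: "int poly \<Rightarrow> nat \<Rightarrow> complex poly" where
  "root_power_poly P n = (\<Prod>\<alpha>\<in>#proots (complex_poly P). [:- (\<alpha> ^ n), 1:])"

definition sq_diff_prod :: "complex list \<Rightarrow> complex" where
  "sq_diff_prod as =
     (\<Prod>(j, k) \<in> {(j, k). j < k \<and> k < length as}. (as ! j - as ! k) ^ 2)"

(* Any enumeration of the roots gives the same value, see sq_diff_prod_mset_cong. *)
definition discriminant :: "complex poly \<Rightarrow> complex" where
  "discriminant p =
     lead_coeff p ^ (2 * degree p - 2) * sq_diff_prod (SOME as. mset as = proots p)"

definition discr_series :: "int poly \<Rightarrow> complex fps" where
  "discr_series P =
     Abs_fps (\<lambda>n. if n = 0 then 0 else discriminant (root_power_poly P n))"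

(* z u'(z) / u(z), as a quotient in the field of formal Laurent series. *)
definition z_log_deriv :: "int poly \<Rightarrow> complex fls" where
  "z_log_deriv u =
     fls_X * fps_to_fls (fps_of_poly (complex_poly (pderiv u)))
       / fps_to_fls (fps_of_poly (complex_poly u))"

lemma sq_diff_prod_mset_cong:
  assumes "mset as = mset bs"
  shows "sq_diff_prod as = sq_diff_prod bs"
proof -
  obtain p where p: "p permutes {..<length bs}" "permute_list p bs = as"
    using mset_eq_permutation[OF assms] by blast
  have len: "length as = length bs"
    using assms mset_eq_length by blast
  have nth: "as ! i = bs ! p i" if "i < length bs" for i
    using permute_list_nth[OF p(1) that] p(2) by simp
  define q where "q = inv p"
  have q: "q permutes {..<length bs}"
    unfolding q_def by (rule permutes_inv[OF p(1)])
  have pq [simp]: "p (q i) = i" "q (p i) = i" for i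
    using permutes_inverses[OF p(1)] by (auto simp: q_def)
  have lt: "p i < length bs" "q i < length bs" if "i < length bs" for i
    using permutes_in_image[OF p(1), of i] permutes_in_image[OF q, of i] that by auto
  have inj: "p i = p j \<longleftrightarrow> i = j" "q i = q j \<longleftrightarrow> i = j" for i j
    by (metis pq)+
  show ?thesis
    unfolding sq_diff_prod_def len
  proof (rule prod.reindex_bij_witness[where
        j = "\<lambda>(i, j). (min (p i) (p j), max (p i) (p j))" and
        i = "\<lambda>(i, j). (min (q i) (q j), max (q i) (q j))"], goal_cases)
    case (1 a)
    then show ?case by (cases a) (auto simp: min_def max_def)
  next
    case (2 a)
    then obtain i j where a: "a = (i, j)" "i < j" "j < length bs" by auto
    hence "p i \<noteq> p j" "p i < length bs" "p j < length bs" using lt(1) inj(1) by simp_all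
    thus ?case using a(1) by (simp add: min_def max_def)
  next
    case (3 a)
    then show ?case by (cases a) (auto simp: min_def max_def)
  next
    case (4 a)
    then obtain i j where a: "a = (i, j)" "i < j" "j < length bs" by auto
    hence "q i \<noteq> q j" "q i < length bs" "q j < length bs" using lt(2) inj(2) by simp_all
    thus ?case using a(1) by (simp add: min_def max_def)
  next
    case (5 a)
    then obtain i j where a: "a = (i, j)" "i < j" "j < length bs" by auto
    have "as ! i = bs ! p i" "as ! j = bs ! p j" using a nth by simp_all
    thus ?case using a(1) by (simp add: min_def max_def power2_commute)
  qed
qed

lemma proots_prod_roots:
  fixes as :: "complex list"
  shows "proots (\<Prod>\<alpha>\<leftarrow>as. [:- \<alpha>, 1:]) = mset as"
proof (induction as)
  case (Cons a as)
  have "(\<Prod>\<alpha>\<leftarrow>as. [:- \<alpha>, 1:]) \<noteq> 0"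
    by (auto simp: prod_list_zero_iff)
  with Cons show ?case
    by (simp add: proots_mult del: mult_pCons_left)
qed simp

lemma discriminant_prod_roots:
  "discriminant (\<Prod>\<alpha>\<leftarrow>as. [:- \<alpha>, 1:]) = sq_diff_prod as"
proof -
  let ?p = "\<Prod>\<alpha>\<leftarrow>as. [:- \<alpha>, 1:]"
  have "lead_coeff ?p = 1"
    by (induction as) (simp_all add: lead_coeff_mult del: mult_pCons_left)
  moreover have "sq_diff_prod (SOME xs. mset xs = proots ?p) = sq_diff_prod as"
  proof (rule sq_diff_prod_mset_cong)
    show "mset (SOME xs. mset xs = proots ?p) = mset as"
      unfolding proots_prod_roots by (rule someI) (rule refl)
  qed
  ultimately show ?thesis
    unfolding discriminant_def
    by (simp only: power_one mult_1)
qed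

lemma discriminant_root_power_poly:
  assumes "complex_poly P = (\<Prod>\<alpha>\<leftarrow>as. [:- \<alpha>, 1:])"
  shows "discriminant (root_power_poly P n) =
    (\<Prod>(j, k) \<in> {(j, k). j < k \<and> k < length as}. (as ! j ^ n - as ! k ^ n) ^ 2)"
proof -
  have "root_power_poly P n = (\<Prod>\<alpha>\<leftarrow>map (\<lambda>\<alpha>. \<alpha> ^ n) as. [:- \<alpha>, 1:])"
    unfolding root_power_poly_def assms proots_prod_roots
    by (simp add: o_def flip: prod_mset_prod_list mset_map)
  hence "discriminant (root_power_poly P n) = sq_diff_prod (map (\<lambda>\<alpha>. \<alpha> ^ n) as)"
    by (simp only: discriminant_prod_roots)
  also have "\<dots> =
    (\<Prod>(j, k) \<in> {(j, k). j < k \<and> k < length as}. (as ! j ^ n - as ! k ^ n) ^ 2)"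
    unfolding sq_diff_prod_def by (intro prod.cong) auto
  finally show ?thesis .
qed

end

theory Submission
  imports Defs
begin

text \<open>
  Expanding the product, \<open>\<Delta>(P\<^sub>n)\<close> is a fixed integer combination of the monomials
  \<open>\<Prod>\<^sub>j \<alpha>\<^sub>j ^ (n * e j)\<close>. As it is symmetric in the roots, it may be averaged over all
  rearrangements, which turns every monomial into the sum of the \<open>n\<close>-th powers of a finite
  family \<open>\<beta>\<close> of numbers, and the generating function of these power sums is \<open>- z u' / u\<close> for
  \<open>u = \<Prod> (1 - \<beta> z)\<close>. By Newton's identities \<open>u\<close> has rational coefficients as soon as the power
  sums of \<open>\<beta>\<close> are rational; these are monomial symmetric functions of the roots, hence
  polynomials in the power sums of the roots, which are rational by Newton's identities again.
\<close>

section \<open>Newton's identities\<close>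

definition power_sum :: "('b \<Rightarrow> 'a) \<Rightarrow> 'b set \<Rightarrow> nat \<Rightarrow> 'a::comm_ring_1" where
  "power_sum \<beta> I n = (\<Sum>i\<in>I. \<beta> i ^ n)"

text \<open>The constant term is 0 instead of the number of indices, because \<open>z u' / u\<close>
  has no constant term when \<open>u\<close> has constant term 1.\<close>

definition power_sum_fps :: "('b \<Rightarrow> 'a) \<Rightarrow> 'b set \<Rightarrow> 'a::comm_ring_1 fps" where
  "power_sum_fps \<beta> I = Abs_fps (\<lambda>n. if n = 0 then 0 else power_sum \<beta> I n)"

text \<open>Its coefficients are the elementary symmetric functions of the family, in increasing
  degree and with alternating signs.\<close>

definition recip_poly :: "('b \<Rightarrow> 'a) \<Rightarrow> 'b set \<Rightarrow> 'a::comm_ring_1 poly" where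
  "recip_poly \<beta> I = (\<Prod>i\<in>I. [:1, - \<beta> i:])"

lemma coeff_0_recip_poly [simp]: "coeff (recip_poly \<beta> I) 0 = 1"
  unfolding recip_poly_def by (induction I rule: infinite_finite_induct) (simp_all add: coeff_mult)

text \<open>Leibniz's rule, one factor at a time: a single factor contributes the geometric series,
  \<open>(1 - b z) * (b z + b^2 z^2 + ...) = b z\<close>. Multiplying out the denominator avoids
  inverses of power series.\<close>

lemma log_deriv_recip_poly:
  fixes \<beta> :: "'b \<Rightarrow> 'a::idom"
  assumes "finite I"
  shows "fps_X * fps_of_poly (pderiv (recip_poly \<beta> I)) =
    - (fps_of_poly (recip_poly \<beta> I) * power_sum_fps \<beta> I)"
  using assms
proof (induction I rule: finite_induct)
  case empty
  have "power_sum_fps \<beta> {} = 0"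
    by (rule fps_ext) (simp add: power_sum_fps_def power_sum_def)
  then show ?case
    by (simp add: recip_poly_def)
next
  case (insert i I)
  define g where "g = power_sum_fps \<beta> {i}"
  have split: "power_sum_fps \<beta> (insert i I) = g + power_sum_fps \<beta> I"
    using insert.hyps by (intro fps_ext) (simp add: g_def power_sum_fps_def power_sum_def)
  have geometric: "fps_of_poly [:1, - \<beta> i:] * g = fps_const (\<beta> i) * fps_X"
  proof (rule fps_ext)
    fix n
    show "(fps_of_poly [:1, - \<beta> i:] * g) $ n = (fps_const (\<beta> i) * fps_X) $ n"
      by (cases n) (auto simp: g_def power_sum_fps_def power_sum_def fps_of_poly_pCons
          algebra_simps)
  qed
  have prod: "recip_poly \<beta> (insert i I) = [:1, - \<beta> i:] * recip_poly \<beta> I"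
    using insert.hyps by (simp add: recip_poly_def del: mult_pCons_left)
  have deriv: "fps_of_poly (pderiv [:1, - \<beta> i:]) = - fps_const (\<beta> i)"
    by (simp add: pderiv_pCons)
  have "fps_X * fps_of_poly (pderiv (recip_poly \<beta> (insert i I))) =
    fps_of_poly [:1, - \<beta> i:] * (fps_X * fps_of_poly (pderiv (recip_poly \<beta> I)))
      - fps_of_poly (recip_poly \<beta> I) * (fps_const (\<beta> i) * fps_X)"
    unfolding prod pderiv_mult fps_of_poly_add fps_of_poly_mult deriv
    by (simp add: algebra_simps)
  also have "\<dots> = - (fps_of_poly (recip_poly \<beta> (insert i I)) * power_sum_fps \<beta> (insert i I))"
    unfolding insert.IH geometric[symmetric] prod split fps_of_poly_mult
    by (simp add: algebra_simps)
  finally show ?case .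
qed

text \<open>Comparison of the coefficients of \<open>z ^ n\<close> in
  \<open>log_deriv_recip_poly\<close>. It holds for every \<open>n\<close>, also beyond the size of
  the family, so it can drive recursions over all \<open>n\<close>.\<close>

lemma newton_identity:
  fixes \<beta> :: "'b \<Rightarrow> 'a::field"
  assumes "finite I"
  shows "of_nat n * coeff (recip_poly \<beta> I) n =
    - (\<Sum>k = 1..n. coeff (recip_poly \<beta> I) (n - k) * power_sum \<beta> I k)"
proof -
  have "of_nat n * coeff (recip_poly \<beta> I) n =
      (fps_X * fps_of_poly (pderiv (recip_poly \<beta> I))) $ n"
    by (cases n) (simp_all add: coeff_pderiv)
  also have "\<dots> = - (power_sum_fps \<beta> I * fps_of_poly (recip_poly \<beta> I)) $ n"
    unfolding log_deriv_recip_poly[OF assms] by (simp add: mult.commute)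
  also have "\<dots> = - (\<Sum>k = 0..n. power_sum_fps \<beta> I $ k * coeff (recip_poly \<beta> I) (n - k))"
    by (simp add: fps_mult_nth)
  also have "\<dots> = - (\<Sum>k = 1..n. coeff (recip_poly \<beta> I) (n - k) * power_sum \<beta> I k)"
    by (subst sum.atLeast_Suc_atMost)
      (auto simp: power_sum_fps_def mult.commute intro!: sum.cong)
  finally show ?thesis .
qed

text \<open>In the summand \<open>k = n\<close> of Newton's identity the coefficient is 1, so each
  power sum is determined by the coefficients and the earlier power sums.\<close>

lemma power_sum_rational:
  fixes \<beta> :: "'b \<Rightarrow> 'a::field_char_0"
  assumes fin: "finite I" and rat: "\<And>n. coeff (recip_poly \<beta> I) n \<in> \<rat>"
  shows "power_sum \<beta> I n \<in> \<rat>"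
proof (induction n rule: less_induct)
  case (less n)
  show ?case
  proof (cases "n = 0")
    case True
    then show ?thesis by (simp add: power_sum_def)
  next
    case False
    have "(\<Sum>k = 1..n. coeff (recip_poly \<beta> I) (n - k) * power_sum \<beta> I k) =
        (\<Sum>k = 1..<n. coeff (recip_poly \<beta> I) (n - k) * power_sum \<beta> I k) + power_sum \<beta> I n"
      using False by (simp add: sum.last_plus add.commute)
    hence "power_sum \<beta> I n = - (of_nat n * coeff (recip_poly \<beta> I) n)
        - (\<Sum>k = 1..<n. coeff (recip_poly \<beta> I) (n - k) * power_sum \<beta> I k)"
      unfolding newton_identity[OF fin] by simp
    also have "\<dots> \<in> \<rat>"
      using less rat by (intro Rats_diff Rats_mult Rats_sum) (auto simp: Rats_minus_iff)
    finally show ?thesis .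
  qed
qed

text \<open>The same recursion read the other way: division by \<open>n\<close> yields the
  \<open>n\<close>-th coefficient from the lower ones and the power sums.\<close>

lemma recip_poly_rational:
  fixes \<beta> :: "'b \<Rightarrow> 'a::field_char_0"
  assumes fin: "finite I" and rat: "\<And>n. power_sum \<beta> I n \<in> \<rat>"
  shows "coeff (recip_poly \<beta> I) n \<in> \<rat>"
proof (induction n rule: less_induct)
  case (less n)
  show ?case
  proof (cases "n = 0")
    case False
    have "(\<Sum>k = 1..n. coeff (recip_poly \<beta> I) (n - k) * power_sum \<beta> I k) \<in> \<rat>"
      using less rat by (intro Rats_sum Rats_mult) auto
    hence "of_nat n * coeff (recip_poly \<beta> I) n / of_nat n \<in> \<rat>"
      unfolding newton_identity[OF fin] by (intro Rats_divide) (auto simp: Rats_minus_iff)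
    then show ?thesis using False by simp
  qed simp
qed

text \<open>Reflection is multiplicative and turns \<open>x - \<alpha>\<close> into
  \<open>1 - \<alpha> x\<close>. This lets the integer coefficients of \<open>P\<close> enter
  Newton's identities.\<close>

lemma recip_poly_roots:
  fixes as :: "'a::field_char_0 list"
  shows "recip_poly ((!) as) {..<length as} = reflect_poly (\<Prod>\<alpha>\<leftarrow>as. [:- \<alpha>, 1:])"
proof -
  have "reflect_poly [:- \<alpha>, 1:] = [:1, - \<alpha>:]" for \<alpha> :: 'a
    by (simp add: reflect_poly_def)
  hence "reflect_poly (\<Prod>\<alpha>\<leftarrow>as. [:- \<alpha>, 1:]) = (\<Prod>\<alpha>\<leftarrow>as. [:1, - \<alpha>:])"
    by (induction as) (simp_all add: reflect_poly_mult del: mult_pCons_left)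
  also have "\<dots> = recip_poly ((!) as) {..<length as}"
    by (simp add: recip_poly_def prod.list_conv_set_nth atLeast0LessThan)
  finally show ?thesis ..
qed

section \<open>Monomial symmetric functions\<close>

text \<open>The lists encode the injections of \<open>{..<k}\<close> into \<open>{..<d}\<close>; for
  \<open>k = d\<close> these are the permutations of \<open>{..<d}\<close>.\<close>

definition index_lists :: "nat \<Rightarrow> nat \<Rightarrow> nat list set" where
  "index_lists d k = {xs. length xs = k \<and> distinct xs \<and> set xs \<subseteq> {..<d}}"

lemma finite_index_lists [simp]: "finite (index_lists d k)"
  by (rule finite_subset[OF _ finite_lists_length_eq[of "{..<d}" k]]) (auto simp: index_lists_def)

lemma index_lists_0 [simp]: "index_lists d 0 = {[]}"
  by (auto simp: index_lists_def)

lemma card_index_lists_pos: "card (index_lists d d) > 0"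
proof -
  have "[0..<d] \<in> index_lists d d"
    by (auto simp: index_lists_def)
  thus ?thesis by (auto simp: card_gt_0_iff)
qed

lemma mset_index_lists:
  assumes "xs \<in> index_lists d d"
  shows "mset xs = mset [0..<d]"
proof -
  have len: "length xs = d" and dist: "distinct xs" and sub: "set xs \<subseteq> {..<d}"
    using assms by (simp_all add: index_lists_def)
  have "set xs = {..<d}"
    by (rule card_subset_eq[OF _ sub]) (simp_all add: len distinct_card[OF dist])
  hence "set xs = set [0..<d]"
    by (simp only: set_upt atLeast0LessThan)
  thus ?thesis
    by (simp only: set_eq_iff_mset_eq_distinct[OF dist distinct_upt])
qed

text \<open>Splitting off the last entry, which has to avoid the others, prepares the recursion on
  \<open>k\<close> for \<open>monomial_sym\<close>.\<close>

lemma sum_index_lists_Suc: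
  "(\<Sum>ys\<in>index_lists d (Suc k). f ys) =
    (\<Sum>xs\<in>index_lists d k. \<Sum>x\<in>{..<d} - set xs. f (xs @ [x]))"
proof -
  have "(\<Sum>xs\<in>index_lists d k. \<Sum>x\<in>{..<d} - set xs. f (xs @ [x])) =
      (\<Sum>(xs, x)\<in>(SIGMA xs:index_lists d k. {..<d} - set xs). f (xs @ [x]))"
    by (rule sum.Sigma) auto
  also have "\<dots> = (\<Sum>ys\<in>index_lists d (Suc k). f ys)"
  proof (rule sum.reindex_bij_witness[where i = "\<lambda>ys. (butlast ys, last ys)" and
        j = "\<lambda>(xs, x). xs @ [x]"], goal_cases)
    case (3 ys)
    then show ?case
      by (cases ys rule: rev_cases) (auto simp: index_lists_def)
  next
    case (4 ys)
    then show ?case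
      by (cases ys rule: rev_cases) (auto simp: index_lists_def)
  qed (auto simp: index_lists_def)
  finally show ?thesis ..
qed

definition monomial :: "nat \<Rightarrow> (nat \<Rightarrow> nat) \<Rightarrow> (nat \<Rightarrow> 'a) \<Rightarrow> 'a::comm_ring_1" where
  "monomial k e a = (\<Prod>j<k. a j ^ e j)"

text \<open>An augmented monomial symmetric function: a monomial counts once for every injection
  that produces it, which keeps multiplicities out of the recursion on \<open>k\<close>.\<close>

definition monomial_sym :: "(nat \<Rightarrow> 'a) \<Rightarrow> nat \<Rightarrow> nat \<Rightarrow> (nat \<Rightarrow> nat) \<Rightarrow> 'a::comm_ring_1" where
  "monomial_sym a d k e = (\<Sum>xs\<in>index_lists d k. monomial k e (\<lambda>j. a (xs ! j)))"

lemma monomial_power: "monomial k e a ^ n = monomial k (\<lambda>j. n * e j) a"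
  by (simp add: monomial_def prod_power_distrib mult.commute flip: power_mult)

lemma monomial_mult: "monomial k e a * monomial k e' a = monomial k (\<lambda>j. e j + e' j) a"
  by (simp add: monomial_def power_add prod.distrib)

lemma monomial_raise:
  assumes "i < k"
  shows "monomial k e a * a i ^ n = monomial k (e(i := e i + n)) a"
proof -
  have "monomial k (e(i := e i + n)) a = a i ^ (e i + n) * (\<Prod>j\<in>{..<k} - {i}. a j ^ e j)"
    unfolding monomial_def using assms by (subst prod.remove[of _ i]) auto
  also have "\<dots> = a i ^ n * monomial k e a"
    unfolding monomial_def using assms by (subst (2) prod.remove[of _ i]) (auto simp: power_add)
  finally show ?thesis by (simp add: mult.commute)
qed

text \<open>Letting the last index run over all of \<open>{..<d}\<close> gives a product with a power sum; the terms
  in which it collides with an earlier index have to be subtracted.\<close>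
lemma monomial_sym_Suc:
  "monomial_sym a d (Suc k) e = power_sum a {..<d} (e k) * monomial_sym a d k e
    - (\<Sum>i<k. monomial_sym a d k (e(i := e i + e k)))"
proof -
  have step: "(\<Sum>x\<in>{..<d} - set xs. monomial (Suc k) e (\<lambda>j. a ((xs @ [x]) ! j))) =
      power_sum a {..<d} (e k) * monomial k e (\<lambda>j. a (xs ! j))
      - (\<Sum>i<k. monomial k (e(i := e i + e k)) (\<lambda>j. a (xs ! j)))"
    if xs: "xs \<in> index_lists d k" for xs
  proof -
    let ?m = "monomial k e (\<lambda>j. a (xs ! j))"
    have len: "length xs = k" and dist: "distinct xs" and sub: "set xs \<subseteq> {..<d}"
      using xs by (auto simp: index_lists_def)
    have "monomial (Suc k) e (\<lambda>j. a ((xs @ [x]) ! j)) = ?m * a x ^ e k" for x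
      using len by (auto simp: monomial_def nth_append intro!: prod.cong arg_cong2[of _ _ _ _ "(*)"])
    hence "(\<Sum>x\<in>{..<d} - set xs. monomial (Suc k) e (\<lambda>j. a ((xs @ [x]) ! j))) =
        ?m * (\<Sum>x\<in>{..<d} - set xs. a x ^ e k)"
      by (simp add: sum_distrib_left)
    also have "(\<Sum>x\<in>{..<d} - set xs. a x ^ e k) =
        power_sum a {..<d} (e k) - (\<Sum>x\<in>set xs. a x ^ e k)"
      unfolding power_sum_def using sub by (intro sum_diff) auto
    also have "(\<Sum>x\<in>set xs. a x ^ e k) = (\<Sum>i<k. a (xs ! i) ^ e k)"
      using bij_betw_nth[OF dist, of "{..<k}" "set xs"] len
      by (intro sum.reindex_bij_betw[symmetric]) auto
    also have "?m * (power_sum a {..<d} (e k) - (\<Sum>i<k. a (xs ! i) ^ e k)) =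
        power_sum a {..<d} (e k) * ?m - (\<Sum>i<k. ?m * a (xs ! i) ^ e k)"
      by (simp add: algebra_simps sum_distrib_left)
    \<comment> \<open>When the last index equals the \<open>i\<close>-th, both powers belong to the
      same variable, so \<open>e k\<close> is added to \<open>e i\<close>.\<close>
    also have "(\<Sum>i<k. ?m * a (xs ! i) ^ e k) =
        (\<Sum>i<k. monomial k (e(i := e i + e k)) (\<lambda>j. a (xs ! j)))"
      by (intro sum.cong refl monomial_raise) simp
    finally show ?thesis .
  qed
  have "monomial_sym a d (Suc k) e = (\<Sum>xs\<in>index_lists d k.
      power_sum a {..<d} (e k) * monomial k e (\<lambda>j. a (xs ! j))
      - (\<Sum>i<k. monomial k (e(i := e i + e k)) (\<lambda>j. a (xs ! j))))"
    unfolding monomial_sym_def sum_index_lists_Suc using step by (intro sum.cong) simp_all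
  also have "\<dots> = power_sum a {..<d} (e k) * monomial_sym a d k e
      - (\<Sum>xs\<in>index_lists d k. \<Sum>i<k. monomial k (e(i := e i + e k)) (\<lambda>j. a (xs ! j)))"
    by (simp add: sum_subtractf sum_distrib_left monomial_sym_def)
  also have "(\<Sum>xs\<in>index_lists d k. \<Sum>i<k. monomial k (e(i := e i + e k)) (\<lambda>j. a (xs ! j))) =
      (\<Sum>i<k. monomial_sym a d k (e(i := e i + e k)))"
    unfolding monomial_sym_def by (rule sum.swap)
  finally show ?thesis .
qed

text \<open>Induction on the number of indices by \<open>monomial_sym_Suc\<close>; \<open>e\<close>
  has to vary because the collision terms change the exponents.\<close>

lemma monomial_sym_rational:
  fixes a :: "nat \<Rightarrow> 'a::field_char_0"
  assumes "\<And>n. power_sum a {..<d} n \<in> \<rat>"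
  shows "monomial_sym a d k e \<in> \<rat>"
proof (induction k arbitrary: e)
  case 0
  show ?case by (simp add: monomial_sym_def monomial_def)
next
  case (Suc k)
  show ?case
    unfolding monomial_sym_Suc using assms Suc
    by (intro Rats_diff Rats_mult Rats_sum) auto
qed

text \<open>Links the two sides of the argument: the family of all rearrangements of one monomial
  has monomial symmetric functions as its power sums.\<close>

lemma power_sum_monomial:
  "power_sum (\<lambda>xs. monomial k e (\<lambda>j. a (xs ! j))) (index_lists d k) n =
    monomial_sym a d k (\<lambda>j. n * e j)"
  by (simp add: power_sum_def monomial_sym_def monomial_power)

section \<open>Expansion into monomials\<close>

text \<open>The list stands for a polynomial in \<open>d\<close> variables. Exponents may repeat, so
  addition is just concatenation.\<close>

definition monomial_expansion ::
  "nat \<Rightarrow> (rat \<times> (nat \<Rightarrow> nat)) list \<Rightarrow> (nat \<Rightarrow> 'a) \<Rightarrow> 'a::field_char_0" where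
  "monomial_expansion d ts a = (\<Sum>(c, e)\<leftarrow>ts. of_rat c * monomial d e a)"

text \<open>One list has to serve all points \<open>a\<close>: the expansion is later evaluated at
  the \<open>n\<close>-th powers of the roots for every \<open>n\<close>.\<close>

definition is_expandable :: "nat \<Rightarrow> ((nat \<Rightarrow> 'a) \<Rightarrow> 'a::field_char_0) \<Rightarrow> bool" where
  "is_expandable d F \<longleftrightarrow> (\<exists>ts. \<forall>a. F a = monomial_expansion d ts a)"

lemma is_expandable_one: "is_expandable d (\<lambda>a. 1)"
  unfolding is_expandable_def
  by (rule exI[of _ "[(1, \<lambda>_. 0)]"]) (simp add: monomial_expansion_def monomial_def)

lemma is_expandable_diff:
  assumes "i < d" "j < d"
  shows "is_expandable d (\<lambda>a. a i - a j)"
proof -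
  have var: "monomial d ((\<lambda>_. 0)(i := 1)) a = a i" if "i < d" for i and a :: "nat \<Rightarrow> 'a"
    using monomial_raise[OF that, of "\<lambda>_. 0" a 1] by (simp add: monomial_def)
  show ?thesis
    unfolding is_expandable_def
    by (rule exI[of _ "[(1, (\<lambda>_. 0)(i := 1)), (- 1, (\<lambda>_. 0)(j := 1))]"])
      (simp only: monomial_expansion_def list.map prod.case sum_list.Cons sum_list.Nil
        var[OF assms(1)] var[OF assms(2)] of_rat_1 of_rat_minus, simp)
qed

text \<open>Distributivity: each term of the first list is multiplied into the whole second list,
  where coefficients multiply and exponents add.\<close>

lemma is_expandable_mult:
  assumes "is_expandable d F" "is_expandable d G"
  shows "is_expandable d (\<lambda>a. F a * G a)"
proof -
  from assms obtain ts us where F: "\<And>a. F a = monomial_expansion d ts a"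
    and G: "\<And>a. G a = monomial_expansion d us a"
    unfolding is_expandable_def by blast
  have single: "monomial_expansion d (map (\<lambda>(c', e'). (c * c', \<lambda>j. e j + e' j)) us) a =
      of_rat c * monomial d e a * monomial_expansion d us a" for c e and a :: "nat \<Rightarrow> 'a"
    by (induction us)
      (auto simp: monomial_expansion_def of_rat_mult algebra_simps simp flip: monomial_mult)
  have "\<exists>vs. \<forall>a :: nat \<Rightarrow> 'a. monomial_expansion d ts a * monomial_expansion d us a =
      monomial_expansion d vs a"
  proof (induction ts)
    case Nil
    show ?case by (rule exI[of _ "[]"]) (simp add: monomial_expansion_def)
  next
    case (Cons t ts)
    obtain c e where t: "t = (c, e)" by (cases t)
    from Cons obtain vs where vs: "\<And>a :: nat \<Rightarrow> 'a.
      monomial_expansion d ts a * monomial_expansion d us a = monomial_expansion d vs a" by blast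
    have app: "monomial_expansion d (xs @ ys) a =
      monomial_expansion d xs a + monomial_expansion d ys a" for xs ys and a :: "nat \<Rightarrow> 'a"
      by (simp add: monomial_expansion_def)
    have cons: "monomial_expansion d (t # ts) a =
      of_rat c * monomial d e a + monomial_expansion d ts a" for a :: "nat \<Rightarrow> 'a"
      by (simp add: monomial_expansion_def t)
    show ?case
      by (rule exI[of _ "map (\<lambda>(c', e'). (c * c', \<lambda>j. e j + e' j)) us @ vs"])
        (simp only: app cons single vs[symmetric] distrib_right simp_thms)
  qed
  thus ?thesis
    unfolding is_expandable_def F G .
qed

lemma is_expandable_prod:
  assumes "\<And>i. i \<in> I \<Longrightarrow> is_expandable d (F i)"
  shows "is_expandable d (\<lambda>a. \<Prod>i\<in>I. F i a)"
  using assms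
  by (induction I rule: infinite_finite_induct) (simp_all add: is_expandable_one is_expandable_mult)

lemma sq_diff_prod_expansion:
  obtains ts where
    "\<And>as. length as = d \<Longrightarrow> sq_diff_prod as = monomial_expansion d ts ((!) as)"
proof -
  \<comment> \<open>The square is written as a product, and the pair through \<open>fst\<close> and
    \<open>snd\<close>, so that the closure rules apply directly.\<close>
  have "is_expandable d (\<lambda>a :: nat \<Rightarrow> complex.
      \<Prod>i\<in>{(j, k). j < k \<and> k < d}. (a (fst i) - a (snd i)) * (a (fst i) - a (snd i)))"
    by (intro is_expandable_prod is_expandable_mult is_expandable_diff) auto
  then obtain ts where ts: "\<And>a :: nat \<Rightarrow> complex.
      (\<Prod>i\<in>{(j, k). j < k \<and> k < d}. (a (fst i) - a (snd i)) * (a (fst i) - a (snd i))) =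
      monomial_expansion d ts a"
    unfolding is_expandable_def by blast
  show ?thesis
  proof (rule that)
    fix as :: "complex list"
    assume "length as = d"
    thus "sq_diff_prod as = monomial_expansion d ts ((!) as)"
      unfolding sq_diff_prod_def ts[symmetric]
      by (simp add: power2_eq_square case_prod_unfold)
  qed
qed

text \<open>\<open>sq_diff_prod\<close> is invariant under rearranging the list. Summing its
  expansion over all rearrangements thus multiplies the value by their number and symmetrises every
  monomial.\<close>

lemma sq_diff_prod_average:
  obtains ts where "\<And>as. length as = d \<Longrightarrow> of_nat (card (index_lists d d)) * sq_diff_prod as =
    (\<Sum>(c, e)\<leftarrow>ts. of_rat c * monomial_sym ((!) as) d d e)"
proof -
  obtain ts where ts:
    "\<And>as. length as = d \<Longrightarrow> sq_diff_prod as = monomial_expansion d ts ((!) as)"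
    using sq_diff_prod_expansion[of d] by blast
  show ?thesis
  proof (rule that)
    fix as :: "complex list"
    assume len: "length as = d"
    have "sq_diff_prod as = monomial_expansion d ts (\<lambda>j. as ! (xs ! j))"
      if xs: "xs \<in> index_lists d d" for xs
    proof -
      have "mset (map ((!) as) xs) = mset (map ((!) as) [0..<d])"
        unfolding mset_map mset_index_lists[OF xs] ..
      also have "map ((!) as) [0..<d] = as"
        using map_nth[of as] len by simp
      finally have "sq_diff_prod as = sq_diff_prod (map ((!) as) xs)"
        by (intro sq_diff_prod_mset_cong) simp
      also have "\<dots> = monomial_expansion d ts ((!) (map ((!) as) xs))"
        using xs by (intro ts) (simp add: index_lists_def)
      also have "\<dots> = monomial_expansion d ts (\<lambda>j. as ! (xs ! j))"
      proof -
        have "monomial d e ((!) (map ((!) as) xs)) = monomial d e (\<lambda>j. as ! (xs ! j))" for e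
          using xs by (simp add: monomial_def index_lists_def)
        thus ?thesis by (simp add: monomial_expansion_def)
      qed
      finally show ?thesis .
    qed
    hence "(\<Sum>xs\<in>index_lists d d. sq_diff_prod as) =
        (\<Sum>xs\<in>index_lists d d. monomial_expansion d ts (\<lambda>j. as ! (xs ! j)))"
      by (intro sum.cong refl)
    hence "of_nat (card (index_lists d d)) * sq_diff_prod as =
        (\<Sum>xs\<in>index_lists d d. monomial_expansion d ts (\<lambda>j. as ! (xs ! j)))"
      by (simp only: sum_constant)
    also have "\<dots> = (\<Sum>(c, e)\<leftarrow>ts. of_rat c * monomial_sym ((!) as) d d e)"
      unfolding monomial_expansion_def monomial_sym_def
      by (induction ts) (auto simp: sum.distrib sum_distrib_left)
    finally show "of_nat (card (index_lists d d)) * sq_diff_prod as =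
      (\<Sum>(c, e)\<leftarrow>ts. of_rat c * monomial_sym ((!) as) d d e)" .
  qed
qed

section \<open>Logarithmic derivatives of integer polynomials\<close>

text \<open>The product of the denominators of the coefficients is a common denominator, built up
  one coefficient at a time.\<close>

lemma clear_denominators:
  fixes p :: "'a::field_char_0 poly"
  assumes "\<And>n. coeff p n \<in> \<rat>"
  obtains q :: int and v :: "int poly" where
    "q \<noteq> 0" "map_poly of_int v = smult (of_int q) p"
proof -
  have "\<exists>(q::int) (v::int poly). q \<noteq> 0 \<and> map_poly of_int v = smult (of_int q) p"
    using assms
  proof (induction p)
    case 0
    show ?case by (intro exI[of _ 1] exI[of _ 0]) simp
  next
    case (pCons a p)
    have "coeff p n \<in> \<rat>" for n
      using pCons.prems[of "Suc n"] by simp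
    then obtain q v where qv: "q \<noteq> 0" "map_poly of_int v = smult (of_int q) p"
      using pCons.IH by blast
    have "a \<in> \<rat>"
      using pCons.prems[of 0] by simp
    then obtain m n where mn: "n > 0" "a = of_int m / of_int n"
      by (cases rule: Rats_cases') auto
    have "map_poly of_int (pCons (q * m) (smult n v)) = smult (of_int (n * q)) (pCons a p)"
      using mn qv by (simp add: map_poly_pCons map_poly_smult mult.commute)
    thus ?case
      using mn qv by (intro exI[of _ "n * q"]) auto
  qed
  thus ?thesis using that by blast
qed

lemma pderiv_map_poly_of_int:
  "pderiv (map_poly of_int v :: 'a::{idom, ring_char_0} poly) = map_poly of_int (pderiv v)"
  by (rule poly_eqI) (simp add: coeff_pderiv coeff_map_poly)

text \<open>Rational power sums make \<open>recip_poly\<close> rational, and clearing its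
  denominators only scales it by a constant, which cancels in the logarithmic derivative.\<close>

lemma power_sum_fps_log_deriv:
  fixes \<beta> :: "'b \<Rightarrow> complex"
  assumes fin: "finite I" and rat: "\<And>n. power_sum \<beta> I n \<in> \<rat>"
  obtains v :: "int poly" where "v \<noteq> 0" "z_log_deriv v = - fps_to_fls (power_sum_fps \<beta> I)"
proof -
  obtain q :: int and v :: "int poly"
    where q: "q \<noteq> 0" and v: "complex_poly v = smult (of_int q) (recip_poly \<beta> I)"
    using clear_denominators recip_poly_rational[OF fin rat] by metis
  have nz: "recip_poly \<beta> I \<noteq> 0"
    using coeff_0_recip_poly[of \<beta> I] by force
  have vnz: "complex_poly v \<noteq> 0"
    unfolding v using q nz by simp
  have "fps_X * fps_of_poly (complex_poly (pderiv v)) =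
      fps_const (of_int q) * (fps_X * fps_of_poly (pderiv (recip_poly \<beta> I)))"
    unfolding pderiv_map_poly_of_int[symmetric] v by (simp add: pderiv_smult fps_of_poly_smult)
  also have "\<dots> = - (fps_of_poly (complex_poly v) * power_sum_fps \<beta> I)"
    unfolding log_deriv_recip_poly[OF fin] v by (simp add: fps_of_poly_smult)
  finally have "fps_to_fls (fps_X * fps_of_poly (complex_poly (pderiv v))) =
      fps_to_fls (- (fps_of_poly (complex_poly v) * power_sum_fps \<beta> I))"
    by simp
  hence "fls_X * fps_to_fls (fps_of_poly (complex_poly (pderiv v))) =
      - fps_to_fls (power_sum_fps \<beta> I) * fps_to_fls (fps_of_poly (complex_poly v))"
    by (simp add: fls_times_fps_to_fls)
  moreover have "fps_to_fls (fps_of_poly (complex_poly v)) \<noteq> 0"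
    using vnz by simp
  ultimately have "z_log_deriv v = - fps_to_fls (power_sum_fps \<beta> I)"
    unfolding z_log_deriv_def by simp
  moreover have "v \<noteq> 0" using vnz by auto
  ultimately show ?thesis using that by blast
qed

section \<open>Factorisation over the complex numbers and assembly of the series\<close>

lemma fps_to_fls_sum: "fps_to_fls (\<Sum>i\<in>I. f i) = (\<Sum>i\<in>I. fps_to_fls (f i))"
  by (induction I rule: infinite_finite_induct) simp_all

text \<open>The fundamental theorem of algebra; a list is used because the expansion into monomials
  refers to the roots by position.\<close>

lemma complex_poly_roots:
  assumes "lead_coeff P = 1"
  obtains as where "complex_poly P = (\<Prod>\<alpha>\<leftarrow>as. [:- \<alpha>, 1:])"
proof -
  obtain as where as: "mset as = proots (complex_poly P)"
    using ex_mset by blast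
  have "lead_coeff (complex_poly P) = 1"
    using assms by (simp add: coeff_map_poly degree_map_poly)
  hence "complex_poly P = (\<Prod>\<alpha>\<in>#proots (complex_poly P). [:- \<alpha>, 1:])"
    using complex_poly_decompose_multiset[of "complex_poly P"] by simp
  also have "\<dots> = (\<Prod>\<alpha>\<leftarrow>as. [:- \<alpha>, 1:])"
    by (simp flip: as prod_mset_prod_list)
  finally show ?thesis by (rule that)
qed

theorem theorem7p3:
  fixes P :: "int poly"
  assumes "lead_coeff P = 1"
  shows "\<exists>(r :: nat) (u :: nat \<Rightarrow> int poly) (c :: nat \<Rightarrow> rat).
    (\<forall>j\<in>{1..r}. u j \<noteq> 0) \<and>
    fps_to_fls (discr_series P) = (\<Sum>j=1..r. fls_const (of_rat (c j)) * z_log_deriv (u j))"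
proof -
  obtain as where as: "complex_poly P = (\<Prod>\<alpha>\<leftarrow>as. [:- \<alpha>, 1:])"
    using complex_poly_roots[OF assms] .
  define d where "d = length as"
  define N where "N = card (index_lists d d)"
  have N: "N > 0"
    unfolding N_def by (rule card_index_lists_pos)
  \<comment> \<open>The expansion is fixed before \<open>n\<close>. Here \<open>as\<close> is bound
    afresh, since \<open>ts\<close> will be applied to the lists of \<open>n\<close>-th
    powers.\<close>
  obtain ts where ts: "\<And>as. length as = d \<Longrightarrow> of_nat N * sq_diff_prod as =
      (\<Sum>(c, e)\<leftarrow>ts. of_rat c * monomial_sym ((!) as) d d e)"
    using sq_diff_prod_average[of d] unfolding N_def by blast
  define \<beta> where "\<beta> e xs = monomial d e (\<lambda>j. as ! (xs ! j))" for e :: "nat \<Rightarrow> nat" and xs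
  define G where "G e = power_sum_fps (\<beta> e) (index_lists d d)" for e
  \<comment> \<open>These are the coefficients of \<open>P\<close> in reverse order, hence
    integers.\<close>
  have "coeff (recip_poly ((!) as) {..<d}) n \<in> \<rat>" for n
    unfolding d_def recip_poly_roots as[symmetric]
    by (auto simp: coeff_reflect_poly coeff_map_poly)
  hence "power_sum ((!) as) {..<d} n \<in> \<rat>" for n
    by (intro power_sum_rational) auto
  hence "power_sum (\<beta> e) (index_lists d d) n \<in> \<rat>" for e n
    unfolding \<beta>_def power_sum_monomial by (intro monomial_sym_rational) auto
  hence "\<exists>v. v \<noteq> 0 \<and> z_log_deriv v = - fps_to_fls (G e)" for e
    unfolding G_def by (metis power_sum_fps_log_deriv finite_index_lists)
  then obtain v where v: "\<And>e. v e \<noteq> 0" "\<And>e. z_log_deriv (v e) = - fps_to_fls (G e)"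
    by metis
  have discr: "discr_series P =
      (\<Sum>i<length ts. fps_const (of_rat (fst (ts ! i) / of_nat N)) * G (snd (ts ! i)))"
  proof (rule fps_ext)
    fix n
    show "discr_series P $ n =
      (\<Sum>i<length ts. fps_const (of_rat (fst (ts ! i) / of_nat N)) * G (snd (ts ! i))) $ n"
    proof (cases "n = 0")
      case True
      then show ?thesis
        by (simp add: discr_series_def fps_sum_nth G_def power_sum_fps_def)
    next
      case False
      \<comment> \<open>Scaling all exponents by \<open>n\<close> amounts to replacing the roots by
        their \<open>n\<close>-th powers, so the coefficient of \<open>G e\<close> matches the
        averaged discriminant of \<open>P\<^sub>n\<close>.\<close>
      have G: "G e $ n = monomial_sym ((!) (map (\<lambda>\<alpha>. \<alpha> ^ n) as)) d d e" for e
      proof -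
        have "monomial d (\<lambda>j. n * e j) (\<lambda>j. as ! (xs ! j)) =
            monomial d e (\<lambda>j. map (\<lambda>\<alpha>. \<alpha> ^ n) as ! (xs ! j))"
          if "xs \<in> index_lists d d" for xs
        proof -
          have "xs ! j < length as" if "j < d" for j
          proof -
            have "xs ! j \<in> set xs"
              using \<open>xs \<in> index_lists d d\<close> that by (intro nth_mem) (simp add: index_lists_def)
            thus ?thesis
              using \<open>xs \<in> index_lists d d\<close> by (auto simp: index_lists_def d_def)
          qed
          thus ?thesis
            by (auto simp: monomial_def power_mult intro!: prod.cong)
        qed
        thus ?thesis
          using False unfolding G_def power_sum_fps_def \<beta>_def power_sum_monomial
          by (simp add: monomial_sym_def cong: sum.cong)
      qed
      have "discr_series P $ n = sq_diff_prod (map (\<lambda>\<alpha>. \<alpha> ^ n) as)"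
        using False unfolding discr_series_def sq_diff_prod_def
        by (auto simp: discriminant_root_power_poly[OF as] intro!: prod.cong)
      also have "\<dots> = (\<Sum>(c, e)\<leftarrow>ts. of_rat c * G e $ n) / of_nat N"
        using ts[of "map (\<lambda>\<alpha>. \<alpha> ^ n) as"] N
        by (simp add: G d_def[symmetric] field_simps)
      also have "\<dots> = (\<Sum>i<length ts. of_rat (fst (ts ! i)) * G (snd (ts ! i)) $ n) / of_nat N"
        by (simp add: sum_list_sum_nth case_prod_unfold atLeast0LessThan)
      also have "\<dots> = (\<Sum>i<length ts.
          fps_const (of_rat (fst (ts ! i) / of_nat N)) * G (snd (ts ! i))) $ n"
        by (simp add: fps_sum_nth sum_divide_distrib of_rat_divide)
      finally show ?thesis .
    qed
  qed
  \<comment> \<open>The list counts from 0 and the required sum from 1, hence \<open>j - 1\<close>.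
    The sign in \<open>?c\<close> cancels the one in
    \<open>z_log_deriv (v e) = - fps_to_fls (G e)\<close>.\<close>
  let ?u = "\<lambda>j. v (snd (ts ! (j - 1)))"
  let ?c = "\<lambda>j. - fst (ts ! (j - 1)) / of_nat N"
  have "fps_to_fls (discr_series P) =
      (\<Sum>i<length ts. fls_const (of_rat (?c (Suc i))) * z_log_deriv (?u (Suc i)))"
    unfolding discr fps_to_fls_sum v(2)
    by (intro sum.cong) (simp_all add: fls_times_fps_to_fls of_rat_minus)
  also have "\<dots> = (\<Sum>j=1..length ts. fls_const (of_rat (?c j)) * z_log_deriv (?u j))"
    by (rule sum.reindex_bij_witness[where i = "\<lambda>j. j - 1" and j = Suc]) auto
  finally show ?thesis
    using v(1) by (intro exI[of _ "length ts"] exI[of _ ?u] exI[of _ ?c]) simp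
qed

end
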